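(* Let $L_0$ be a finite co-Brouwerian semilattice and $L$ a finite minimal extension of $L_0$. Then either $L=L_0\langle x\rangle$ for some $x\in L$ primitive of the first kind over $L_0$, or $L=L_0\langle x_1,x_2\rangle$ for some $x_1,x_2\in L$ such that $(x_1,x_2)$ is a primitive couple of the second kind over $L_0$.
   Context: A co-Brouwerian semilattice (CBS) is a poset with least element $0$, binary joins $\vee$ and a difference $-$ characterized by $a-b\le c$ iff $a\le b\vee c$; sub-CBSes, extensions are in the signature $(0,\vee,-)$, and $L_0\langle S\rangle$ denotes the sub-CBS generated by $L_0\cup S$. An element $g$ is join-irreducible if for all $n\ge0$ and $b_1,\dots,b_n$, $g\le b_1\vee\dots\vee b_n$ implies $g\le b_i$ for some $i$. An extension $L_0\subseteq L$ of finite CBSes is minimal if $L_0\ne L$ and no sub-CBS lies strictly between them. For $L$ an extension of finite $L_0$: $x\in L$ is primitive of the first kind over $L_0$ if $x\notin L_0$ and for every join-irreducible $a$ of $L_0$, $a-x\in L_0$ and ($x-a=x$ or $x-a=0$). A pair $(x_1,x_2)\in L^2$ is a primitive couple of the second kind over $L_0$ if $x_1,x_2\notin L_0$, $x_1\ne x_2$, and there is a join-irreducible $g$ of $L_0$ with $g-x_1=x_2$, $g-x_2=x_1$, and $a-x_i\in L_0$ ($i=1,2$) for every join-irreducible $a$ of $L_0$ with $a<g$. *)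

theory Defs
  imports Main "HOL.Hull"
begin

class co_brouwerian_semilattice = bounded_semilattice_sup_bot + minus +
  assumes diff_le_iff: "a - b \<le> c \<longleftrightarrow> a \<le> sup b c"

instance set :: (type) co_brouwerian_semilattice
  by standard auto

text \<open>
  All algebras are carriers of subalgebras of one ambient co-Brouwerian semilattice, which is
  arbitrary (it may be the largest algebra under consideration, with carrier \<open>UNIV\<close>). Thus an
  extension of \<open>L0\<close> is a subalgebra \<open>L\<close> with \<open>L0 \<subseteq> L\<close>.
\<close>

definition sub_cbs :: "'a::co_brouwerian_semilattice set \<Rightarrow> bool" where
  "sub_cbs M \<longleftrightarrow> bot \<in> M \<and> (\<forall>a\<in>M. \<forall>b\<in>M. sup a b \<in> M \<and> a - b \<in> M)"

definition adjoin ::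
  "'a::co_brouwerian_semilattice set \<Rightarrow> 'a set \<Rightarrow> 'a set" where
  "adjoin L0 S = sub_cbs hull (L0 \<union> S)"

definition minimal_extension ::
  "'a::co_brouwerian_semilattice set \<Rightarrow> 'a set \<Rightarrow> bool" where
  "minimal_extension L0 L \<longleftrightarrow>
     sub_cbs L0 \<and> sub_cbs L \<and> L0 \<subset> L \<and> (\<nexists>M. sub_cbs M \<and> L0 \<subset> M \<and> M \<subset> L)"

text \<open>
  Join-irreducibility is relative to the carrier \<open>M\<close>. The list \<open>bs\<close> is the family
  \<open>b\<^sub>1, \<dots>, b\<^sub>n\<close>; the empty list excludes \<open>g = bot\<close>.
\<close>

definition join_irreducible ::
  "'a::co_brouwerian_semilattice set \<Rightarrow> 'a \<Rightarrow> bool" where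
  "join_irreducible M g \<longleftrightarrow>
     g \<in> M \<and> (\<forall>bs. set bs \<subseteq> M \<longrightarrow> g \<le> foldr sup bs bot \<longrightarrow> (\<exists>b\<in>set bs. g \<le> b))"

definition primitive_first_kind ::
  "'a::co_brouwerian_semilattice set \<Rightarrow> 'a \<Rightarrow> bool" where
  "primitive_first_kind L0 x \<longleftrightarrow>
     x \<notin> L0 \<and>
     (\<forall>a. join_irreducible L0 a \<longrightarrow> a - x \<in> L0 \<and> (x - a = x \<or> x - a = bot))"

definition primitive_couple_second_kind ::
  "'a::co_brouwerian_semilattice set \<Rightarrow> 'a \<Rightarrow> 'a \<Rightarrow> bool" where
  "primitive_couple_second_kind L0 x1 x2 \<longleftrightarrow>
     x1 \<notin> L0 \<and> x2 \<notin> L0 \<and> x1 \<noteq> x2 \<and>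
     (\<exists>g. join_irreducible L0 g \<and> g - x1 = x2 \<and> g - x2 = x1 \<and>
        (\<forall>a. join_irreducible L0 a \<longrightarrow> a < g \<longrightarrow> a - x1 \<in> L0 \<and> a - x2 \<in> L0))"

end

(*
  A minimal element x of L - L0 has all its strict lower bounds (within L) in L0, so it is
  join-irreducible in L and x - a is x or bot for every a in L. If a - x lies in L0 for all
  join-irreducibles a of L0, then x is primitive of the first kind. Otherwise let g be a minimal
  join-irreducible of L0 with g - x not in L0. Then g - (g - x) <= x, and it cannot be strictly
  below x: it would lie in L0, and join-irreducibility of g would give g <= x or g - x = g.
  Hence (x, g - x) is a primitive couple of the second kind. By minimality of the extension,
  adjoining any element outside L0 yields L.
*)
theory Submission
  imports Defs
begin

context co_brouwerian_semilattice
begin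

lemma le_sup_diff: "a \<le> sup b (a - b)"
  using diff_le_iff by blast

lemma diff_le: "a - b \<le> a"
  by (simp add: diff_le_iff)

lemma diff_eq_bot_iff: "a - b = bot \<longleftrightarrow> a \<le> b"
  by (metis diff_le_iff bot_unique sup_bot_right)

lemma diff_antimono: "b \<le> c \<Longrightarrow> a - c \<le> a - b"
  by (meson diff_le_iff le_sup_diff order.trans order_refl sup_mono)

lemma diff_diff_le: "a - (a - b) \<le> b"
  using diff_le_iff le_sup_diff sup_commute by metis

text \<open>The map \<open>b \<mapsto> a - b\<close> is antitone and forms a Galois connection with
  itself, since \<open>a - b \<le> c\<close> iff \<open>a - c \<le> b\<close>; hence three
  applications collapse to one.\<close>

lemma diff_diff_diff: "a - (a - (a - b)) = a - b"
  by (simp add: order.antisym diff_diff_le diff_antimono)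

end

lemma sub_cbs_sup: "sub_cbs M \<Longrightarrow> a \<in> M \<Longrightarrow> b \<in> M \<Longrightarrow> sup a b \<in> M"
  and sub_cbs_diff: "sub_cbs M \<Longrightarrow> a \<in> M \<Longrightarrow> b \<in> M \<Longrightarrow> a - b \<in> M"
  and sub_cbs_bot: "sub_cbs M \<Longrightarrow> bot \<in> M"
  by (auto simp: sub_cbs_def)

lemma sub_cbs_adjoin: "sub_cbs (adjoin L0 S)"
  unfolding adjoin_def by (rule hull_in) (auto simp: sub_cbs_def)

lemma subset_adjoin: "L0 \<union> S \<subseteq> adjoin L0 S"
  unfolding adjoin_def by (rule hull_subset)

lemma adjoin_subset: "sub_cbs M \<Longrightarrow> L0 \<union> S \<subseteq> M \<Longrightarrow> adjoin L0 S \<subseteq> M"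
  unfolding adjoin_def by (rule hull_minimal)

text \<open>The adjoined algebra lies inside \<open>L\<close> and strictly contains
  \<open>L0\<close>, so minimality leaves only \<open>L\<close>.\<close>

lemma minimal_extension_adjoin:
  assumes "minimal_extension L0 L" and "S \<subseteq> L" and "\<not> S \<subseteq> L0"
  shows "L = adjoin L0 S"
  using assms sub_cbs_adjoin[of L0 S] subset_adjoin[of L0 S] adjoin_subset[of L L0 S]
  unfolding minimal_extension_def by blast

lemma join_irreducible_le_sup:
  assumes "join_irreducible M g" and "b \<in> M" and "c \<in> M" and "g \<le> sup b c"
  shows "g \<le> b \<or> g \<le> c"
proof -
  have "set [b, c] \<subseteq> M" and "g \<le> foldr sup [b, c] bot"
    using assms by auto
  then have "\<exists>d\<in>set [b, c]. g \<le> d"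
    using assms(1) unfolding join_irreducible_def by blast
  then show ?thesis by simp
qed

text \<open>Since \<open>g \<le> sup b (g - b)\<close> with both parts in \<open>M\<close>,
  join-irreducibility puts \<open>g\<close> below one of them.\<close>

lemma join_irreducible_diff:
  assumes "sub_cbs M" and "join_irreducible M g" and "b \<in> M"
  shows "g \<le> b \<or> g - b = g"
proof -
  have "g \<in> M" using assms(2) by (simp add: join_irreducible_def)
  then have "g \<le> b \<or> g \<le> g - b"
    using join_irreducible_le_sup[OF assms(2,3)] sub_cbs_diff assms(1,3) le_sup_diff by blast
  then show ?thesis using diff_le order.antisym by blast
qed

text \<open>The element \<open>x\<close> is the join of \<open>x - a\<close> and
  \<open>x - (x - a)\<close>. If both were strictly below \<open>x\<close>, they would lie in
  \<open>L0\<close>, and so would \<open>x\<close>.\<close>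

lemma minimal_new_element_diff:
  assumes "sub_cbs L0" and "sub_cbs L" and "x \<in> L - L0"
    and below: "\<And>y. y \<in> L \<Longrightarrow> y < x \<Longrightarrow> y \<in> L0"
    and "a \<in> L"
  shows "x - a = x \<or> x - a = bot"
proof (rule ccontr)
  assume neg: "\<not> ?thesis"
  let ?c = "x - (x - a)"
  have L: "x - a \<in> L" "?c \<in> L"
    using assms by (auto intro: sub_cbs_diff)
  have "x - a < x" using neg diff_le order.not_eq_order_implies_strict by blast
  moreover have "?c < x"
  proof -
    \<comment> \<open>Equality would give \<open>x \<le> a\<close>, that is,
      \<open>x - a = bot\<close>.\<close>
    have "?c \<noteq> x" using neg diff_diff_le[of x a] by (auto simp: diff_eq_bot_iff)
    then show ?thesis using diff_le order.not_eq_order_implies_strict by blast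
  qed
  ultimately have "sup (x - a) ?c \<in> L0"
    using below L assms(1) by (auto intro: sub_cbs_sup)
  moreover have "sup (x - a) ?c = x"
    by (rule order.antisym) (simp_all add: diff_le le_sup_diff)
  ultimately show False using assms(3) by simp
qed

text \<open>The choice of \<open>g\<close> gives the condition on \<open>a - x\<close> directly. The
  work lies in \<open>g - (g - x) = x\<close> and in the membership of \<open>a - (g - x)\<close> in
  \<open>L0\<close>.\<close>

lemma primitive_couple_of_minimal:
  assumes L0: "sub_cbs L0" and L: "sub_cbs L" and sub: "L0 \<subseteq> L" and x: "x \<in> L - L0"
    and below: "\<And>y. y \<in> L \<Longrightarrow> y < x \<Longrightarrow> y \<in> L0"
    and g: "join_irreducible L0 g" and gx: "g - x \<notin> L0"
    and least: "\<And>a. join_irreducible L0 a \<Longrightarrow> a < g \<Longrightarrow> a - x \<in> L0"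
  shows "primitive_couple_second_kind L0 x (g - x)"
proof -
  have gL0: "g \<in> L0" using g by (simp add: join_irreducible_def)
  have not_le: "\<not> g \<le> x"
    using gx sub_cbs_bot[OF L0] diff_eq_bot_iff by metis
  have neq: "g - x \<noteq> g" using gx gL0 by auto
  have in_L: "a - (g - x) \<in> L" if "a \<in> L0" for a
    using that gL0 x sub L by (blast intro: sub_cbs_diff)
  have gg: "g - (g - x) = x"
  proof (rule ccontr)
    assume "g - (g - x) \<noteq> x"
    then have "g - (g - x) < x" using diff_diff_le order.not_eq_order_implies_strict by blast
    then have "g - (g - x) \<in> L0" using below in_L gL0 by blast
    then have "g \<le> g - (g - x) \<or> g - (g - (g - x)) = g"
      by (rule join_irreducible_diff[OF L0 g])
    \<comment> \<open>The first alternative forces \<open>g \<le> x\<close>; the second collapses to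
      \<open>g - x = g\<close>.\<close>
    then show False
      using not_le neq diff_diff_le order.trans unfolding diff_diff_diff by blast
  qed
  have "x \<noteq> g - x"
    using le_sup_diff[of g x] not_le by auto
  moreover have "a - (g - x) \<in> L0" if a: "join_irreducible L0 a" "a < g" for a
  proof (cases "a - (g - x) = x")
    case True
    have aL0: "a \<in> L0" using a by (simp add: join_irreducible_def)
    have "x \<le> a" using True diff_le[of a "g - x"] by simp
    \<comment> \<open>As \<open>g\<close> is not below \<open>a\<close>, subtracting
      \<open>a\<close> leaves \<open>g\<close> unchanged. With \<open>x \<le> a\<close> this yields
      \<open>g = g - a \<le> g - x\<close>, contradicting \<open>g - x \<noteq> g\<close>.\<close>
    moreover have "g - a = g"
      using join_irreducible_diff[OF L0 g aL0] a(2) by auto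
    ultimately have "g \<le> g - x" using diff_antimono[of x a g] by simp
    then show ?thesis using neq diff_le order.antisym by blast
  next
    case False
    \<comment> \<open>This unfolds to \<open>a \<le> sup (g - x) x\<close>, which holds because
      \<open>g\<close> is already below that join.\<close>
    have "a - (g - x) \<le> x"
      using a(2) le_sup_diff[of g x]
      by (simp add: diff_le_iff sup_commute order.strict_implies_order order.trans)
    then have "a - (g - x) < x" using False by simp
    then show ?thesis using below in_L a by (simp add: join_irreducible_def)
  qed
  ultimately show ?thesis
    unfolding primitive_couple_second_kind_def using x gx g gg least by blast
qed

theorem theorem3p16:
  fixes L0 L :: "'a::co_brouwerian_semilattice set"
  assumes "finite L0" and "finite L" and "minimal_extension L0 L"
  shows "(\<exists>x\<in>L. primitive_first_kind L0 x \<and> L = adjoin L0 {x}) \<or>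
         (\<exists>x1\<in>L. \<exists>x2\<in>L. primitive_couple_second_kind L0 x1 x2 \<and> L = adjoin L0 {x1, x2})"
proof -
  have L0: "sub_cbs L0" and L: "sub_cbs L" and sub: "L0 \<subset> L"
    using assms(3) by (auto simp: minimal_extension_def)
  obtain x where x: "x \<in> L - L0" and min: "\<And>y. y \<in> L - L0 \<Longrightarrow> y \<le> x \<Longrightarrow> x = y"
    using finite_has_minimal[of "L - L0"] assms(2) sub by blast
  then have below: "y \<in> L0" if "y \<in> L" "y < x" for y
    using that by (metis DiffI order.strict_iff_order)
  \<comment> \<open>These are the obstructions to \<open>x\<close> being of the first kind; a
    minimal one serves as the \<open>g\<close> of the couple.\<close>
  let ?B = "{a. join_irreducible L0 a \<and> a - x \<notin> L0}"
  show ?thesis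
  proof (cases "?B = {}")
    case True
    have "primitive_first_kind L0 x"
      unfolding primitive_first_kind_def
    proof (intro conjI allI impI)
      show "x \<notin> L0" using x by simp
      fix a assume a: "join_irreducible L0 a"
      show "a - x \<in> L0" using a True by blast
      have "a \<in> L0" using a by (simp add: join_irreducible_def)
      then show "x - a = x \<or> x - a = bot"
        using minimal_new_element_diff[OF L0 L x below] sub by blast
    qed
    moreover have "L = adjoin L0 {x}"
      using minimal_extension_adjoin[OF assms(3)] x by simp
    ultimately show ?thesis using x by blast
  next
    case False
    have "finite ?B"
      using assms(1) by (rule rev_finite_subset) (auto simp: join_irreducible_def)
    then obtain g where g: "join_irreducible L0 g" "g - x \<notin> L0"
      and gmin: "\<And>a. a \<in> ?B \<Longrightarrow> a \<le> g \<Longrightarrow> g = a"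
      using finite_has_minimal[of ?B] False by blast
    have "primitive_couple_second_kind L0 x (g - x)"
      using primitive_couple_of_minimal[OF L0 L _ x below g] sub gmin
      by (metis (mono_tags, lifting) mem_Collect_eq order.strict_iff_order psubset_imp_subset)
    moreover have "g - x \<in> L"
      using g(1) x sub L by (auto simp: join_irreducible_def intro: sub_cbs_diff)
    moreover have "L = adjoin L0 {x, g - x}"
      using minimal_extension_adjoin[OF assms(3)] x \<open>g - x \<in> L\<close> by simp
    ultimately show ?thesis using x by blast
  qed
qed

end
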